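(* Let $\Lambda=\{0,\dots,N\}\setminus\{k_1,\dots,k_M\}$, where $N$ and $k_1<k_2<\dots<k_M<N$ are positive integers ($M\ge 0$). Suppose that $p\in\mathcal P(\Lambda)$ and $\|p\|_1=1$. Let $m$ be the number and $\mathfrak M=\mathfrak M(p)$ the real $2M\times(2m+1)$ matrix associated with $p$ as defined in the context. Then $p$ is an extreme point of $\mathrm{ball}(\mathcal P(\Lambda))$ if and only if $\operatorname{rank}\mathfrak M=2m$.
   Context: Let $\mathbb T=\{\zeta\in\mathbb C:|\zeta|=1\}$ and $\mathbb D=\{z\in\mathbb C:|z|<1\}$. Let $\mathcal P_N$ be the set of complex polynomials of degree at most $N$, and let $\mathcal P(\Lambda)$ be the complex vector space of polynomials of the form $\sum_{k\in\Lambda}c_kz^k$ with $c_k\in\mathbb C$, normed by $\|f\|_1=\frac1{2\pi}\int_{\mathbb T}|f(\zeta)|\,|d\zeta|$ (restricting polynomials to $\mathbb T$). When $M=0$ the set $\{k_1,\dots,k_M\}$ is empty and $\mathcal P(\Lambda)=\mathcal P_N$. For a normed space $X$, $\mathrm{ball}(X)=\{x\in X:\|x\|\le1\}$. A point of $\mathrm{ball}(X)$ is extreme if it is not an interior point of any (nondegenerate) line segment contained in $\mathrm{ball}(X)$. For $p(z)=\sum_{k=0}^Nc_kz^k\in\mathcal P_N$ put $p^*(z)=\sum_{k=0}^N\overline{c_k}\,z^{N-k}$ (so $p^*(z)=z^N\overline{p(1/\bar z)}$ for $z\ne0$). Construction of $m$ and $\mathfrak M$ from a unit-norm $p\in\mathcal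 P(\Lambda)$. Let $a_1,\dots,a_n$ ($n\ge0$) be the distinct common zeros of $p$ and $p^*$ lying in $\mathbb D$, let $m_j=\min\{\mathrm{mult}(a_j,p),\mathrm{mult}(a_j,p^* )\}$, where $\mathrm{mult}(a_j,\cdot)$ is the multiplicity of the zero at $a_j$, and let $m=\sum_{j=1}^nm_j$. Put $$G(z)=\prod_{j=1}^n(z-a_j)^{m_j}(1-\overline{a_j}z)^{m_j},\qquad R(z)=p(z)/G(z).$$ Then $R$ is a polynomial of degree at most $N-2m$. For $k\in\mathbb Z$, let $C_k$ be the coefficient of $z^k$ in $R$ (with $C_k=0$ for $k\notin[0,N-2m]$), and let $A(k)=\mathrm{Re}\,C_k$, $B(k)=\mathrm{Im}\,C_k$. For $j=1,\dots,M$ and $l=0,\dots,m$, put $$A^{+}_{j,l}=A(k_j+l-m)+A(k_j-l-m),\qquad B^{+}_{j,l}=B(k_j+l-m)+B(k_j-l-m),$$ $$A^{-}_{j,l}=A(k_j+l-m)-A(k_j-l-m),\qquad B^{-}_{j,l}=B(k_j+l-m)-B(k_j-l-m).$$ Let $\mathcal A^+=\{A^+_{j,l}\}$ and $\mathcal B^+=\{B^+_{j,l}\}$ be the $M\times(m+1)$ matrices with row index $j=1,\dots,M$ and column index $l=0,\dots,m$, and let $\mathcal A^-=\{A^-_{j,l}\}$ and $\mathcal B^-=\{B^-_{j,l}\}$ be the $M\times m$ matrices with row index $j=1,\dots,M$ and column index $l=1,\dots,m$ (absent if $m=0$). Finally, $$\mathfrak M=\begin{pmatrix}\mathcal A^+&\mathcal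 B^-\\ \mathcal B^+&-\mathcal A^-\end{pmatrix},$$ a real matrix with $2M$ rows and $2m+1$ columns. If $M=0$, $\mathfrak M$ has no rows and its rank is $0$. *)

theory Defs
  imports
    "HOL-Analysis.Analysis"
    "HOL-Computational_Algebra.Polynomial"
    "Jordan_Normal_Form.DL_Rank"
begin

text \<open>
  Polynomials as a real vector space, so that the library notion
  \<^const>\<open>extreme_point_of\<close> applies to sets of polynomials.
\<close>

instantiation poly :: (real_vector) real_vector
begin

definition scaleR_poly :: "real \<Rightarrow> 'a poly \<Rightarrow> 'a poly" where
  "scaleR_poly r p = map_poly (\<lambda>c. r *\<^sub>R c) p"

lemma coeff_scaleR_poly: "poly.coeff (r *\<^sub>R p) i = r *\<^sub>R poly.coeff p i"
  for p :: "'a poly"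
  by (simp add: scaleR_poly_def coeff_map_poly)

instance
  by standard
    (auto intro!: poly_eqI simp: coeff_scaleR_poly scaleR_add_right scaleR_add_left)

end

definition poly_space :: "nat set \<Rightarrow> complex poly set" where
  "poly_space \<Lambda> = {p. \<forall>i. poly.coeff p i \<noteq> 0 \<longrightarrow> i \<in> \<Lambda>}"

definition spectrum_set :: "nat \<Rightarrow> nat \<Rightarrow> (nat \<Rightarrow> nat) \<Rightarrow> nat set" where
  "spectrum_set N M k = {0..N} - k ` {1..M}"

definition circle_norm1 :: "complex poly \<Rightarrow> real" where
  "circle_norm1 p = 1 / (2 * pi) * integral {0..2 * pi} (\<lambda>t. cmod (poly p (cis t)))"

definition unit_ball1 :: "nat set \<Rightarrow> complex poly set" where
  "unit_ball1 \<Lambda> = {p \<in> poly_space \<Lambda>. circle_norm1 p \<le> 1}"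

definition star_poly :: "nat \<Rightarrow> complex poly \<Rightarrow> complex poly" where
  "star_poly N p = (\<Sum>i\<le>N. Polynomial.monom (cnj (poly.coeff p i)) (N - i))"

definition common_zeros :: "nat \<Rightarrow> complex poly \<Rightarrow> complex set" where
  "common_zeros N p = {a. cmod a < 1 \<and> poly p a = 0 \<and> poly (star_poly N p) a = 0}"

definition common_mult :: "nat \<Rightarrow> complex poly \<Rightarrow> complex \<Rightarrow> nat" where
  "common_mult N p a = min (Polynomial.order a p) (Polynomial.order a (star_poly N p))"

definition m_of :: "nat \<Rightarrow> complex poly \<Rightarrow> nat" where
  "m_of N p = (\<Sum>a\<in>common_zeros N p. common_mult N p a)"

definition G_poly :: "nat \<Rightarrow> complex poly \<Rightarrow> complex poly" where
  "G_poly N p = (\<Prod>a\<in>common_zeros N p.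
     [:- a, 1:] ^ common_mult N p a * [:1, - cnj a:] ^ common_mult N p a)"

text \<open>
  For a nonzero \<open>p\<close> of degree at most \<open>N\<close> the polynomial \<open>G_poly N p\<close> divides \<open>p\<close>,
  so that the polynomial division below is exact.
\<close>

definition R_poly :: "nat \<Rightarrow> complex poly \<Rightarrow> complex poly" where
  "R_poly N p = p div G_poly N p"

definition C_coeff :: "nat \<Rightarrow> complex poly \<Rightarrow> int \<Rightarrow> complex" where
  "C_coeff N p i = (if 0 \<le> i then poly.coeff (R_poly N p) (nat i) else 0)"

definition A_coeff :: "nat \<Rightarrow> complex poly \<Rightarrow> int \<Rightarrow> real" where
  "A_coeff N p i = Re (C_coeff N p i)"

definition B_coeff :: "nat \<Rightarrow> complex poly \<Rightarrow> int \<Rightarrow> real" where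
  "B_coeff N p i = Im (C_coeff N p i)"

text \<open>
  For \<open>X\<close> one of the sequences \<open>A\<close>, \<open>B\<close>, these are the numbers
  \<open>X(k\<^sub>j + l - m) \<plusminus> X(k\<^sub>j - l - m)\<close>.
\<close>

definition plus_entry :: "(int \<Rightarrow> real) \<Rightarrow> nat \<Rightarrow> (nat \<Rightarrow> nat) \<Rightarrow> nat \<Rightarrow> nat \<Rightarrow> real" where
  "plus_entry X m k j l =
     X (int (k j) + int l - int m) + X (int (k j) - int l - int m)"

definition minus_entry :: "(int \<Rightarrow> real) \<Rightarrow> nat \<Rightarrow> (nat \<Rightarrow> nat) \<Rightarrow> nat \<Rightarrow> nat \<Rightarrow> real" where
  "minus_entry X m k j l =
     X (int (k j) + int l - int m) - X (int (k j) - int l - int m)"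

text \<open>
  Library matrices are indexed from \<open>0\<close>: the row index \<open>j = 1, \<dots>, M\<close> is shifted by one, and so is
  the column index \<open>l = 1, \<dots>, m\<close> of the minus matrices; the columns \<open>l = 0, \<dots>, m\<close> of the plus
  matrices are not shifted.
\<close>

definition plus_mat :: "(int \<Rightarrow> real) \<Rightarrow> nat \<Rightarrow> nat \<Rightarrow> (nat \<Rightarrow> nat) \<Rightarrow> real mat" where
  "plus_mat X m M k = mat M (m + 1) (\<lambda>(i, l). plus_entry X m k (i + 1) l)"

definition minus_mat :: "(int \<Rightarrow> real) \<Rightarrow> nat \<Rightarrow> nat \<Rightarrow> (nat \<Rightarrow> nat) \<Rightarrow> real mat" where
  "minus_mat X m M k = mat M m (\<lambda>(i, l). minus_entry X m k (i + 1) (l + 1))"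

definition frakM :: "nat \<Rightarrow> nat \<Rightarrow> (nat \<Rightarrow> nat) \<Rightarrow> complex poly \<Rightarrow> real mat" where
  "frakM N M k p =
     (let m = m_of N p; A = A_coeff N p; B = B_coeff N p in
      four_block_mat
        (plus_mat A m M k) (minus_mat B m M k)
        (plus_mat B m M k) (- minus_mat A m M k))"

text \<open>
  \<^const>\<open>vec_space.rank\<close> is the dimension of the column space; its first explicit argument is the
  length of the columns.
\<close>

definition mat_rank :: "real mat \<Rightarrow> nat" where
  "mat_rank X = vec_space.rank (dim_row X) X"

end

theory Submission
  imports
    Defs
    "HOL-Computational_Algebra.Fundamental_Theorem_Algebra"
    "Jordan_Normal_Form.Matrix_Kernel"
begin

text \<open>
  Write \<open>T\<close> for the unit circle, \<open>m\<close> for \<open>m_of N p\<close>, \<open>G\<close> and \<open>R\<close> for the polynomials with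
  \<open>p = G R\<close>, and \<open>s*\<close> for the reversed conjugate polynomial.  The theorem follows from three
  equivalences.

  \<^item> In an \<open>L\<^sup>1\<close> norm, \<open>p\<close> fails to be extreme exactly when some \<open>q\<close> of the space that is not a real
    multiple of \<open>p\<close> has a bounded real quotient \<open>q / p\<close> on \<open>T\<close>.  If \<open>p = x + y\<close> comes from a
    segment, equality in the triangle inequality for the norm forces
    \<open>\<bar>x + y\<bar> = \<bar>x\<bar> + \<bar>y\<bar>\<close> pointwise, so that \<open>x / p\<close> is real with values in \<open>[0, 1]\<close>
    (\<open>not_extreme_imp_real_ratio\<close>).  Conversely, if \<open>q = h p\<close> with \<open>h\<close> real and bounded,
    subtracting a constant from \<open>h\<close> achieves \<open>\<integral> h \<bar>p\<bar> = 0\<close>, and for the new \<open>h\<close> both \<open>p + \<epsilon> h p\<close> and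
    \<open>p - \<epsilon> h p\<close> have norm \<open>1\<close> when \<open>\<epsilon>\<close> is small (\<open>real_ratio_imp_not_extreme\<close>).

  \<^item> The polynomials \<open>q\<close> of degree at most \<open>N\<close> with \<open>q / p\<close> real and bounded on \<open>T\<close> are exactly the
    products \<open>R s\<close> in which \<open>s\<close> has degree at most \<open>2 m\<close> and \<open>s* = s\<close>.  Reality of \<open>q / p\<close> on \<open>T\<close> is
    the identity \<open>q p* = q* p\<close>.  Since \<open>G* = G\<close>, this reduces to \<open>q R* = q* R\<close>.  By the choice of \<open>G\<close>,
    the polynomials \<open>R\<close> and \<open>R*\<close> have common zeros only on \<open>T\<close>; off \<open>T\<close> the identity makes every zero
    of \<open>R\<close> a zero of \<open>q\<close> of at least the same order, on \<open>T\<close> boundedness does, so \<open>R\<close> divides \<open>q\<close>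
    (\<open>real_ratio_imp_multiple_of_R\<close>).  Conversely, \<open>R s / p = s / G\<close> is real on \<open>T\<close>, where \<open>G\<close> has no
    zeros (\<open>self_reciprocal_ratio_real\<close>).  The polynomial \<open>p\<close> itself corresponds to \<open>s = G\<close>.

  \<^item> A polynomial \<open>s\<close> with \<open>s* = s\<close> is given by \<open>2 m + 1\<close> real coordinates.  The vanishing of the
    coefficients of \<open>R s\<close> at the excluded exponents, split into real and imaginary parts, is the
    linear system with matrix \<open>frakM N M k p\<close> (\<open>frakM_kernel_iff\<close>).

  Hence \<open>p\<close> is extreme if and only if the kernel of this matrix is the line spanned by the
  coordinate vector of \<open>G\<close>, that is, by rank-nullity, if and only if the rank is \<open>2 m\<close>.
\<close>

text \<open>
  The symbol \<open>$\<close> below always denotes an entry of a vector with explicit length, not of a vector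
  indexed by a finite type.
\<close>

unbundle no vec_syntax

section \<open>Rank and kernel of a matrix\<close>

lemma (in vec_space) span_cols_eq_range:
  assumes A: "A \<in> carrier_mat n nc"
  shows "span (set (cols A)) = (\<lambda>v. A *\<^sub>v v) ` carrier_vec nc"
proof -
  have c: "set (cols A) \<subseteq> carrier_vec n"
    using cols_dim A by blast
  have d: "\<forall>w\<in>set (cols A). dim_vec w = n"
    using c by auto
  have A': "mat_of_cols n (cols A) = A"
    using A by auto
  have l: "length (cols A) = nc"
    using A by simp
  have "span (set (cols A)) = span_list (cols A)"
    by (rule span_list_as_span[OF c, symmetric])
  also have "\<dots> = {A *\<^sub>v vec nc f | f. True}"
    unfolding span_list_def using lincomb_list_as_mat_mult[OF d] A' l by auto
  also have "\<dots> = (\<lambda>v. A *\<^sub>v v) ` carrier_vec nc"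
  proof (rule subset_antisym; rule subsetI)
    fix x assume "x \<in> (\<lambda>v. A *\<^sub>v v) ` carrier_vec nc"
    then obtain v where v: "v \<in> carrier_vec nc" "x = A *\<^sub>v v" by auto
    moreover have "vec nc (\<lambda>i. v $ i) = v" using v by auto
    ultimately show "x \<in> {A *\<^sub>v vec nc f | f. True}" by (metis (mono_tags, lifting) mem_Collect_eq)
  qed auto
  finally show ?thesis .
qed

lemma rank_plus_kernel_dim:
  fixes A :: "'a :: field mat"
  assumes A: "A \<in> carrier_mat nr nc"
  shows "vec_space.rank nr A
    + vectorspace.dim class_ring ((module_vec TYPE('a) nc)\<lparr>carrier := {v \<in> carrier_vec nc. A *\<^sub>v v = 0\<^sub>v nr}\<rparr>) = nc"
proof -
  interpret D: vec_space "TYPE('a)" nc .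
  interpret C: vec_space "TYPE('a)" nr .
  interpret T: linear_map class_ring "module_vec TYPE('a) nc" "module_vec TYPE('a) nr" "\<lambda>v. A *\<^sub>v v"
    by unfold_locales
      (use A in \<open>auto simp: module_hom_def module_vec_simps class_ring_simps mult_add_distrib_mat_vec mult_mat_vec\<close>)
  have im: "T.im = C.span (set (cols A))"
    unfolding T.im_def C.span_cols_eq_range[OF A] by (simp add: module_vec_simps)
  have ker: "T.ker = {v \<in> carrier_vec nc. A *\<^sub>v v = 0\<^sub>v nr}"
    unfolding T.ker_def by (simp add: module_vec_simps)
  show ?thesis
    using T.rank_nullity[OF D.fin_dim] unfolding im ker C.rank_def D.dim_is_n .
qed

lemma (in vectorspace) dim_eq_1_iff:
  assumes fd: fin_dim and u: "u \<in> carrier V" "u \<noteq> \<zero>\<^bsub>V\<^esub>"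
  shows "dim = 1 \<longleftrightarrow> (\<forall>v\<in>carrier V. \<exists>c\<in>carrier K. v = c \<odot>\<^bsub>V\<^esub> u)"
proof -
  have lc: "lincomb a {u} = a u \<odot>\<^bsub>V\<^esub> u" if "a \<in> {u} \<rightarrow> carrier K" for a
    using that u lincomb_insert[of "{}" a u] by (auto simp: lincomb_def)
  have li: "lin_indpt {u}"
  proof (rule finite_lin_indpt2)
    fix a assume a: "a \<in> {u} \<rightarrow> carrier K" "lincomb a {u} = \<zero>\<^bsub>V\<^esub>"
    show "\<forall>v\<in>{u}. a v = \<zero>\<^bsub>K\<^esub>"
    proof (rule ccontr)
      assume "\<not> ?thesis"
      then have nz: "a u \<in> Units K" and au: "a u \<in> carrier K"
        using a(1) field_Units by auto
      then have "u = (inv\<^bsub>K\<^esub> (a u) \<otimes>\<^bsub>K\<^esub> a u) \<odot>\<^bsub>V\<^esub> u"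
        using u by simp
      also have "\<dots> = inv\<^bsub>K\<^esub> (a u) \<odot>\<^bsub>V\<^esub> lincomb a {u}"
        using u nz au lc[OF a(1)] by (simp add: smult_assoc1[symmetric])
      finally show False
        using u a(2) nz smult_r_null by simp
    qed
  qed (use u in auto)
  have span: "span {u} = {c \<odot>\<^bsub>V\<^esub> u | c. c \<in> carrier K}"
  proof -
    have "span {u} = {lincomb a {u} |a. a \<in> {u} \<rightarrow> carrier K}"
      by (rule finite_span) (use u in auto)
    also have "\<dots> = {c \<odot>\<^bsub>V\<^esub> u | c. c \<in> carrier K}"
    proof (rule subset_antisym; rule subsetI)
      fix x assume "x \<in> {c \<odot>\<^bsub>V\<^esub> u | c. c \<in> carrier K}"
      then obtain c where c: "c \<in> carrier K" "x = c \<odot>\<^bsub>V\<^esub> u" by auto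
      then have "x = lincomb (\<lambda>_. c) {u}" using lc[of "\<lambda>_. c"] by simp
      then show "x \<in> {lincomb a {u} |a. a \<in> {u} \<rightarrow> carrier K}" using c by blast
    qed (use lc in auto)
    finally show ?thesis .
  qed
  show ?thesis
  proof
    assume "dim = 1"
    then have "basis {u}"
      using dim_li_is_basis[OF fd _ _ li] u by auto
    then show "\<forall>v\<in>carrier V. \<exists>c\<in>carrier K. v = c \<odot>\<^bsub>V\<^esub> u"
      unfolding basis_def span by auto
  next
    assume "\<forall>v\<in>carrier V. \<exists>c\<in>carrier K. v = c \<odot>\<^bsub>V\<^esub> u"
    then have "basis {u}"
      unfolding basis_def span using li u by auto
    from dim_basis[OF _ this] show "dim = 1" by simp
  qed
qed

lemma rank_eq_ncols_minus_1_iff: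
  fixes A :: "'a :: field mat"
  assumes A: "A \<in> carrier_mat nr (Suc d)"
    and u: "u \<in> carrier_vec (Suc d)" "u \<noteq> 0\<^sub>v (Suc d)" "A *\<^sub>v u = 0\<^sub>v nr"
  shows "vec_space.rank nr A = d
    \<longleftrightarrow> (\<forall>v\<in>carrier_vec (Suc d). A *\<^sub>v v = 0\<^sub>v nr \<longrightarrow> (\<exists>c. v = c \<cdot>\<^sub>v u))"
proof -
  interpret kernel nr "Suc d" A
    by unfold_locales (rule A)
  have fd: "Ker.fin_dim"
    using kernel_basis_exists[OF A] unfolding Ker.basis_def Ker.fin_dim_def by blast
  have "dim = 1 \<longleftrightarrow> (\<forall>v\<in>mat_kernel A. \<exists>c. v = c \<cdot>\<^sub>v u)"
    using Ker.dim_eq_1_iff[OF fd, of u] u mat_kernelI[OF A u(1,3)] by (simp add: class_ring_simps)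
  moreover have "vec_space.rank nr A + dim = Suc d"
    using rank_plus_kernel_dim[OF A] unfolding mat_kernel[OF A] .
  ultimately show ?thesis using mat_kernel[OF A] by auto
qed

section \<open>Reversed conjugate polynomials\<close>

lemma coeff_star_poly:
  "poly.coeff (star_poly N p) i = (if i \<le> N then cnj (poly.coeff p (N - i)) else 0)"
proof -
  have "poly.coeff (star_poly N p) i = (\<Sum>j\<le>N. if i = N - j then cnj (poly.coeff p j) else 0)"
    by (simp add: star_poly_def coeff_sum) (rule sum.cong, auto)
  also have "\<dots> = (\<Sum>j\<le>N. if j = N - i then if i \<le> N then cnj (poly.coeff p (N - i)) else 0 else 0)"
    by (rule sum.cong) auto
  finally show ?thesis by simp
qed

lemma degree_star_poly_le: "degree (star_poly N p) \<le> N"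
  by (rule degree_le) (simp add: coeff_star_poly)

lemma star_poly_star_poly: "degree p \<le> N \<Longrightarrow> star_poly N (star_poly N p) = p"
  by (rule poly_eqI) (auto simp: coeff_star_poly coeff_eq_0)

lemma star_poly_eq_0_iff: "degree p \<le> N \<Longrightarrow> star_poly N p = 0 \<longleftrightarrow> p = 0"
proof
  assume "degree p \<le> N" "star_poly N p = 0"
  then show "p = 0" using star_poly_star_poly[of p N] by (simp add: star_poly_def)
qed (simp add: star_poly_def)

lemma poly_star_poly:
  assumes "degree p \<le> N" "z \<noteq> 0"
  shows "poly (star_poly N p) z = z ^ N * cnj (poly p (1 / cnj z))"
proof -
  have pw: "z ^ (N - i) = z ^ N * (1 / z) ^ i" if "i \<le> N" for i
    using that assms(2) by (simp add: power_diff power_one_over)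
  have "poly p (1 / cnj z) = (\<Sum>i\<le>N. poly.coeff p i * (1 / cnj z) ^ i)"
    unfolding poly_altdef
    by (rule sum.mono_neutral_left) (use assms(1) in \<open>auto simp: coeff_eq_0\<close>)
  then have "z ^ N * cnj (poly p (1 / cnj z)) = (\<Sum>i\<le>N. cnj (poly.coeff p i) * (z ^ N * (1 / z) ^ i))"
    by (simp add: sum_distrib_left algebra_simps)
  also have "\<dots> = (\<Sum>i\<le>N. cnj (poly.coeff p i) * z ^ (N - i))"
    by (rule sum.cong) (simp_all add: pw)
  finally show ?thesis
    by (simp add: star_poly_def poly_sum poly_monom)
qed

lemma poly_star_poly_circle:
  assumes "degree p \<le> N" "cmod z = 1"
  shows "poly (star_poly N p) z = z ^ N * cnj (poly p z)"
proof -
  have "z \<noteq> 0" "z * cnj z = 1"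
    using assms(2) by (auto simp: complex_norm_square[symmetric])
  then have "1 / cnj z = z" by (simp add: field_simps)
  then show ?thesis using poly_star_poly[OF assms(1) \<open>z \<noteq> 0\<close>] by simp
qed

lemma infinite_unit_circle: "infinite {z. cmod z = 1}"
proof
  assume "finite {z. cmod z = 1}"
  moreover have "{z. z ^ Suc n = 1} \<subseteq> {z. cmod z = 1}" for n
    by (metis (mono_tags, lifting) mem_Collect_eq subsetI norm_power norm_one power_eq_1_iff zero_less_Suc norm_ge_zero power_eq_imp_eq_base power_one zero_le_one)
  ultimately have "card {z::complex. z ^ Suc n = 1} \<le> card {z. cmod z = 1}" for n
    by (rule card_mono)
  then have "Suc n \<le> card {z. cmod z = 1}" for n
    using card_roots_unity_eq[of "Suc n"] by (metis zero_less_Suc)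
  then show False using not_less_eq_eq by blast
qed

text \<open>
  A polynomial is determined by its values on the circle, where \<open>star_poly N p\<close> takes the values
  \<open>z ^ N * cnj (poly p z)\<close> if \<open>p\<close> has degree at most \<open>N\<close>; multiplicativity of \<^const>\<open>star_poly\<close> follows.
\<close>
lemma poly_eqI_circle:
  assumes "\<And>z. cmod z = 1 \<Longrightarrow> poly p z = poly q z"
  shows "p = q"
proof (rule ccontr)
  assume "p \<noteq> q"
  then have "finite {z. poly (p - q) z = 0}"
    by (intro poly_roots_finite) simp
  moreover have "{z. cmod z = 1} \<subseteq> {z. poly (p - q) z = 0}"
    using assms by auto
  ultimately show False using infinite_unit_circle finite_subset by blast
qed

lemma star_poly_mult:
  assumes "degree p \<le> a" "degree q \<le> b"
  shows "star_poly (a + b) (p * q) = star_poly a p * star_poly b q"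
proof (rule poly_eqI_circle)
  fix z :: complex assume z: "cmod z = 1"
  have "degree (p * q) \<le> a + b"
    using degree_mult_le[of p q] assms by linarith
  then show "poly (star_poly (a + b) (p * q)) z = poly (star_poly a p * star_poly b q) z"
    using z assms by (simp add: poly_star_poly_circle power_add)
qed

lemma star_poly_1: "star_poly 0 1 = 1"
  by (rule poly_eqI) (auto simp: coeff_star_poly)

lemma star_poly_linear: "star_poly 1 [:- a, 1:] = [:1, - cnj a:]"
  by (rule poly_eqI) (auto simp: coeff_star_poly coeff_pCons split: nat.splits)

lemma star_poly_power:
  assumes "degree p \<le> a"
  shows "star_poly (a * n) (p ^ n) = star_poly a p ^ n"
proof (induction n)
  case (Suc n)
  have "degree (p ^ n) \<le> a * n"
    using degree_power_le[of p n] assms by (meson le_trans mult_le_mono1)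
  then show ?case using star_poly_mult[OF assms, of "p ^ n" "a * n"] Suc by simp
qed (simp add: star_poly_1)

lemma star_poly_prod:
  assumes "finite S" "\<And>x. x \<in> S \<Longrightarrow> degree (f x) \<le> d x"
  shows "star_poly (sum d S) (prod f S) = (\<Prod>x\<in>S. star_poly (d x) (f x))"
  using assms
proof (induction S rule: finite_induct)
  case (insert x S)
  have "degree (prod f S) \<le> sum d S"
    using degree_prod_sum_le[OF insert(1), of f] sum_mono[of S "\<lambda>x. degree (f x)" d] insert by (force intro: order_trans)
  then show ?case using insert by (simp add: star_poly_mult)
qed (simp add: star_poly_1)

text \<open>
  A degree drop of \<open>p\<close> below \<open>N\<close>, a zero at infinity, is a zero of \<open>star_poly N p\<close> at the origin.
\<close>
lemma order_0_star_poly: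
  assumes "degree p \<le> N" "p \<noteq> 0"
  shows "Polynomial.order 0 (star_poly N p) = N - degree p"
proof -
  have "Polynomial.monom 1 n dvd star_poly N p \<longleftrightarrow> n \<le> N - degree p" for n
  proof
    assume *: "Polynomial.monom 1 n dvd star_poly N p"
    show "n \<le> N - degree p"
    proof (rule ccontr)
      assume "\<not> ?thesis"
      then have "poly.coeff (star_poly N p) (N - degree p) = 0"
        using * unfolding monom_1_dvd_iff' by auto
      then show False using assms by (simp add: coeff_star_poly)
    qed
  next
    assume "n \<le> N - degree p"
    then show "Polynomial.monom 1 n dvd star_poly N p"
      unfolding monom_1_dvd_iff' by (auto simp: coeff_star_poly intro!: coeff_eq_0)
  qed
  then show ?thesis
    using monom_1_dvd_iff[of "star_poly N p"] star_poly_eq_0_iff assms by (metis order_antisym order_refl)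
qed

section \<open>Removing the common zeros in the disc\<close>

lemma dvd_if_order_le:
  fixes p q :: "complex poly"
  assumes "p \<noteq> 0" "q \<noteq> 0" "\<And>a. poly q a = 0 \<Longrightarrow> Polynomial.order a q \<le> Polynomial.order a p"
  shows "q dvd p"
proof -
  have "proots q \<subseteq># proots p"
    unfolding subseteq_mset_def using assms order_0I by (metis count_proots le0)
  then obtain B where B: "proots p = proots q + B"
    by (metis mset_subset_eq_exists_conv)
  have "p = Polynomial.smult (lead_coeff p) (\<Prod>x\<in>#proots p. [:- x, 1:])"
       "q = Polynomial.smult (lead_coeff q) (\<Prod>x\<in>#proots q. [:- x, 1:])"
    using complex_poly_decompose_multiset by metis+
  moreover have "lead_coeff q \<noteq> 0" using assms by simp
  ultimately have "p = q * Polynomial.smult (lead_coeff p / lead_coeff q) (\<Prod>x\<in>#B. [:- x, 1:])"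
    unfolding B by (metis (no_types, lifting) image_mset_union mult_smult_left mult_smult_right nonzero_eq_divide_eq prod_mset_Un smult_smult)
  then show ?thesis by (rule dvdI)
qed

lemma order_prod_linear_powers:
  fixes e :: "'a :: idom \<Rightarrow> nat"
  assumes "finite S"
  shows "Polynomial.order b (\<Prod>a\<in>S. [:- a, 1:] ^ e a) = (if b \<in> S then e b else 0)"
  using assms
proof (induction S rule: finite_induct)
  case (insert x S)
  have 1: "Polynomial.order b ([:- x, 1:] ^ e x) = (if b = x then e x else 0)"
    by (auto simp: order_power_n_n intro!: order_0I)
  have 2: "[:- x, 1:] ^ e x * (\<Prod>a\<in>S. [:- a, 1:] ^ e a) \<noteq> 0"
    using insert(1) by (simp add: prod_zero_iff)
  show ?case
    unfolding prod.insert[OF insert(1,2)] order_mult[OF 2] 1 insert.IH using insert(2) by auto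
qed simp

text \<open>
  The half of \<open>G_poly N p\<close> that collects the zeros in the open disc.  The other half, with the zeros
  reflected in the circle, is its image under \<^const>\<open>star_poly\<close>.
\<close>
definition disc_factor :: "nat \<Rightarrow> complex poly \<Rightarrow> complex poly" where
  "disc_factor N p = (\<Prod>a\<in>common_zeros N p. [:- a, 1:] ^ common_mult N p a)"

lemma finite_common_zeros: "p \<noteq> 0 \<Longrightarrow> finite (common_zeros N p)"
  by (rule finite_subset[OF _ poly_roots_finite[of p]]) (auto simp: common_zeros_def)

lemma degree_disc_factor:
  assumes "p \<noteq> 0"
  shows "degree (disc_factor N p) = m_of N p"
  unfolding disc_factor_def m_of_def
  by (subst degree_prod_sum_eq) (auto simp: degree_power_eq)

lemma disc_factor_neq_0: "p \<noteq> 0 \<Longrightarrow> disc_factor N p \<noteq> 0"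
  using finite_common_zeros[of p N] by (simp add: disc_factor_def prod_zero_iff)

lemma order_disc_factor:
  "p \<noteq> 0 \<Longrightarrow> Polynomial.order b (disc_factor N p) = (if b \<in> common_zeros N p then common_mult N p b else 0)"
  unfolding disc_factor_def by (rule order_prod_linear_powers) (rule finite_common_zeros)

lemma poly_disc_factor_neq_0:
  assumes "p \<noteq> 0" "1 \<le> cmod z"
  shows "poly (disc_factor N p) z \<noteq> 0"
  using assms finite_common_zeros[of p N]
  by (auto simp: disc_factor_def poly_prod common_zeros_def)

lemma poly_star_disc_factor_neq_0:
  assumes "p \<noteq> 0" "cmod z \<le> 1"
  shows "poly (star_poly (m_of N p) (disc_factor N p)) z \<noteq> 0"
proof -
  let ?g = "disc_factor N p"
  have dg: "degree ?g \<le> m_of N p" "?g \<noteq> 0"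
    using assms by (simp_all add: degree_disc_factor disc_factor_neq_0)
  show ?thesis
  proof (cases "z = 0")
    case True
    have "Polynomial.order 0 (star_poly (m_of N p) ?g) = 0"
      using order_0_star_poly[OF dg] degree_disc_factor[OF assms(1)] by simp
    then show ?thesis using True star_poly_eq_0_iff[OF dg(1)] dg(2) by (simp add: order_eq_0_iff)
  next
    case False
    then have "1 \<le> cmod (1 / cnj z)" using assms(2) by (simp add: norm_divide)
    then show ?thesis
      using poly_disc_factor_neq_0[OF assms(1)] poly_star_poly[OF dg(1) False] False by simp
  qed
qed

lemma G_poly_eq:
  assumes "p \<noteq> 0"
  shows "G_poly N p = disc_factor N p * star_poly (m_of N p) (disc_factor N p)"
proof -
  have "star_poly (m_of N p) (disc_factor N p)
    = (\<Prod>a\<in>common_zeros N p. star_poly (common_mult N p a) ([:- a, 1:] ^ common_mult N p a))"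
    unfolding m_of_def disc_factor_def
    by (rule star_poly_prod[OF finite_common_zeros[OF assms]]) (simp add: degree_power_eq)
  also have "\<dots> = (\<Prod>a\<in>common_zeros N p. [:1, - cnj a:] ^ common_mult N p a)"
    using star_poly_power[of "[:- a, 1:]" 1 for a] star_poly_linear by simp
  finally show ?thesis
    by (simp add: G_poly_def disc_factor_def prod.distrib)
qed

context
  fixes N :: nat and p :: "complex poly"
  assumes p: "p \<noteq> 0" "degree p \<le> N"
begin

lemma degree_disc_factor_le: "degree (disc_factor N p) \<le> m_of N p"
  using degree_disc_factor[OF p(1)] by simp

lemma disc_factor_dvd: "disc_factor N p dvd p" "disc_factor N p dvd star_poly N p"
proof -
  have sp: "star_poly N p \<noteq> 0" using p star_poly_eq_0_iff by blast
  show "disc_factor N p dvd p" "disc_factor N p dvd star_poly N p"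
    by (rule dvd_if_order_le; use p sp disc_factor_neq_0 in
        \<open>auto simp: order_disc_factor common_mult_def\<close>)+
qed

text \<open>
  Reversing \<open>star_poly N p = g h\<close>, where \<open>g\<close> is the disc factor, gives the reflected factor of \<open>p\<close>.
\<close>
lemma star_disc_factor_dvd: "star_poly (m_of N p) (disc_factor N p) dvd p"
proof -
  obtain h where h: "star_poly N p = disc_factor N p * h" using disc_factor_dvd(2) by (elim dvdE)
  have sp: "star_poly N p \<noteq> 0" using p star_poly_eq_0_iff by blast
  then have "degree (star_poly N p) = m_of N p + degree h"
    using h degree_mult_eq[of "disc_factor N p" h] degree_disc_factor[OF p(1)] by auto
  then have d: "degree h \<le> N - m_of N p" "m_of N p \<le> N"
    using degree_star_poly_le[of N p] by linarith+
  have "p = star_poly (m_of N p + (N - m_of N p)) (disc_factor N p * h)"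
    using star_poly_star_poly[OF p(2)] h d by simp
  also have "\<dots> = star_poly (m_of N p) (disc_factor N p) * star_poly (N - m_of N p) h"
    by (rule star_poly_mult) (use d degree_disc_factor_le in auto)
  finally show ?thesis by (rule dvdI)
qed

lemma G_poly_dvd: "G_poly N p dvd p"
proof (rule dvd_if_order_le)
  have GG: "disc_factor N p \<noteq> 0" "star_poly (m_of N p) (disc_factor N p) \<noteq> 0"
    using disc_factor_neq_0[OF p(1)] star_poly_eq_0_iff[OF degree_disc_factor_le] by auto
  then have ggp: "disc_factor N p * star_poly (m_of N p) (disc_factor N p) \<noteq> 0" by simp
  then show "G_poly N p \<noteq> 0" using G_poly_eq[OF p(1)] by simp
  fix a
  have eq: "Polynomial.order a (G_poly N p) = Polynomial.order a (disc_factor N p) + Polynomial.order a (star_poly (m_of N p) (disc_factor N p))"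
    unfolding G_poly_eq[OF p(1)] by (rule order_mult[OF ggp])
  show "Polynomial.order a (G_poly N p) \<le> Polynomial.order a p"
  proof (cases "cmod a < 1")
    case True
    then show ?thesis
      using eq poly_star_disc_factor_neq_0[OF p(1), of a] dvd_imp_order_le[OF p(1) disc_factor_dvd(1)]
      by (simp add: order_0I)
  next
    case False
    then show ?thesis
      using eq poly_disc_factor_neq_0[OF p(1), of a] dvd_imp_order_le[OF p(1) star_disc_factor_dvd]
      by (simp add: order_0I)
  qed
qed (rule p)

lemma G_poly_times_R_poly: "p = G_poly N p * R_poly N p"
  using G_poly_dvd by (simp add: R_poly_def)

lemma G_poly_neq_0: "G_poly N p \<noteq> 0"
  using G_poly_times_R_poly p by auto

lemma R_poly_neq_0: "R_poly N p \<noteq> 0"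
  using G_poly_times_R_poly p by auto

lemma degree_G_poly_le: "degree (G_poly N p) \<le> 2 * m_of N p"
  unfolding G_poly_eq[OF p(1)]
  using degree_mult_le[of "disc_factor N p" "star_poly (m_of N p) (disc_factor N p)"] degree_disc_factor_le degree_star_poly_le[of "m_of N p" "disc_factor N p"] by linarith

lemma star_G_poly: "star_poly (2 * m_of N p) (G_poly N p) = G_poly N p"
  unfolding G_poly_eq[OF p(1)] mult_2
  by (subst star_poly_mult) (simp_all add: degree_disc_factor_le degree_star_poly_le star_poly_star_poly)

lemma poly_G_poly_circle: "cmod z = 1 \<Longrightarrow> poly (G_poly N p) z \<noteq> 0"
  unfolding G_poly_eq[OF p(1)]
  using poly_disc_factor_neq_0[OF p(1), of z] poly_star_disc_factor_neq_0[OF p(1), of z] by simp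

text \<open>
  A common zero at the origin lowers the degree of \<open>G_poly N p\<close> below \<open>2 m\<close>, as its reflection lies
  at infinity.  The degree of \<open>p\<close> is then lower than \<open>N\<close> by at least as much, because \<open>star_poly N p\<close>
  vanishes at the origin to that order.
\<close>
lemma degree_R_poly_add_le: "degree (R_poly N p) + 2 * m_of N p \<le> N"
proof -
  have GG: "disc_factor N p \<noteq> 0" "star_poly (m_of N p) (disc_factor N p) \<noteq> 0"
    using disc_factor_neq_0[OF p(1)] star_poly_eq_0_iff[OF degree_disc_factor_le] by auto
  have sp: "star_poly N p \<noteq> 0" using p star_poly_eq_0_iff by blast
  have "Polynomial.order 0 (disc_factor N p) = m_of N p - degree (star_poly (m_of N p) (disc_factor N p))"
    using order_0_star_poly[of "star_poly (m_of N p) (disc_factor N p)" "m_of N p"] GG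
    by (simp add: degree_star_poly_le star_poly_star_poly degree_disc_factor_le)
  moreover have "Polynomial.order 0 (disc_factor N p) \<le> N - degree p"
    using dvd_imp_order_le[OF sp disc_factor_dvd(2), of 0] order_0_star_poly[OF p(2,1)] by simp
  moreover have "degree p = m_of N p + degree (star_poly (m_of N p) (disc_factor N p)) + degree (R_poly N p)"
  proof -
    have "degree p = degree (G_poly N p) + degree (R_poly N p)"
      using G_poly_times_R_poly degree_mult_eq[OF G_poly_neq_0 R_poly_neq_0] by simp
    also have "degree (G_poly N p) = m_of N p + degree (star_poly (m_of N p) (disc_factor N p))"
      unfolding G_poly_eq[OF p(1)] degree_mult_eq[OF GG] by (simp add: degree_disc_factor[OF p(1)])
    finally show ?thesis .
  qed
  ultimately show ?thesis using degree_star_poly_le[of "m_of N p" "disc_factor N p"] p(2) by linarith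
qed

lemma degree_R_poly_le: "degree (R_poly N p) \<le> N - 2 * m_of N p"
  using degree_R_poly_add_le by linarith

lemma star_poly_eq_G_times_star_R:
  "star_poly N p = G_poly N p * star_poly (N - 2 * m_of N p) (R_poly N p)"
proof -
  have "star_poly (2 * m_of N p + (N - 2 * m_of N p)) (G_poly N p * R_poly N p)
     = G_poly N p * star_poly (N - 2 * m_of N p) (R_poly N p)"
    by (subst star_poly_mult) (simp_all add: degree_G_poly_le degree_R_poly_le star_G_poly)
  then show ?thesis using G_poly_times_R_poly degree_R_poly_add_le by simp
qed

lemma R_poly_no_common_zero_disc:
  assumes "cmod a < 1" "poly (R_poly N p) a = 0"
  shows "poly (star_poly (N - 2 * m_of N p) (R_poly N p)) a \<noteq> 0"
proof
  let ?R = "R_poly N p" and ?G = "G_poly N p"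
  let ?S = "star_poly (N - 2 * m_of N p) ?R"
  assume S0: "poly ?S a = 0"
  have sp: "star_poly N p \<noteq> 0" using p star_poly_eq_0_iff by blast
  have S: "?S \<noteq> 0" using R_poly_neq_0 star_poly_eq_0_iff[OF degree_R_poly_le] by blast
  have "poly p a = 0" using G_poly_times_R_poly assms(2) by (metis mult_zero_right poly_mult)
  moreover have "poly (star_poly N p) a = 0" using star_poly_eq_G_times_star_R S0 by simp
  ultimately have az: "a \<in> common_zeros N p" using assms(1) by (simp add: common_zeros_def)
  \<comment> \<open>\<open>G\<close> already vanishes at \<open>a\<close> to the smaller of the orders of \<open>p = G R\<close> and of \<open>star_poly N p = G S\<close>,
    with \<open>S\<close> the reversal of \<open>R\<close>, so \<open>R\<close> and \<open>S\<close> cannot both vanish there.\<close>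
  have "common_mult N p a \<le> Polynomial.order a ?G"
    using order_disc_factor[OF p(1), of a N] az G_poly_eq[OF p(1)]
      dvd_imp_order_le[OF G_poly_neq_0, of "disc_factor N p" a] by simp
  moreover have "Polynomial.order a p = Polynomial.order a ?G + Polynomial.order a ?R"
    using order_mult[of ?G ?R a] G_poly_times_R_poly p(1) by simp
  moreover have "Polynomial.order a (star_poly N p) = Polynomial.order a ?G + Polynomial.order a ?S"
    using order_mult[of ?G ?S a] star_poly_eq_G_times_star_R sp by simp
  moreover have "Polynomial.order a ?R > 0" "Polynomial.order a ?S > 0"
    using assms(2) S0 S R_poly_neq_0 by (simp_all add: order_gt_0_iff)
  ultimately show False by (simp add: common_mult_def)
qed

lemma R_poly_no_common_zero:
  assumes "cmod a \<noteq> 1" "poly (R_poly N p) a = 0"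
  shows "poly (star_poly (N - 2 * m_of N p) (R_poly N p)) a \<noteq> 0"
proof (cases "cmod a < 1")
  case True
  then show ?thesis using R_poly_no_common_zero_disc assms(2) by blast
next
  case False
  let ?R = "R_poly N p"
  let ?b = "1 / cnj a"
  have a: "a \<noteq> 0" "cmod a > 1" using False assms(1) by auto
  then have b: "cmod ?b < 1" "?b \<noteq> 0" "1 / cnj ?b = a" by (simp_all add: norm_divide)
  show ?thesis
  proof
    assume "poly (star_poly (N - 2 * m_of N p) ?R) a = 0"
    then have "poly ?R ?b = 0"
      using poly_star_poly[OF degree_R_poly_le a(1)] a(1) by simp
    moreover have "poly (star_poly (N - 2 * m_of N p) ?R) ?b = 0"
      using poly_star_poly[OF degree_R_poly_le b(2)] assms(2) b(3) by simp
    ultimately show False using R_poly_no_common_zero_disc[OF b(1)] by blast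
  qed
qed

end

section \<open>Real quotients on the circle\<close>

text \<open>
  If \<open>q\<close> vanished to lower order than \<open>p\<close> at \<open>a\<close>, dividing the bound by the power of \<open>z - a\<close> and
  letting \<open>z\<close> tend to \<open>a\<close> along the circle would leave a nonzero value bounded by zero.
\<close>
lemma order_le_of_circle_bound:
  fixes p q :: "complex poly"
  assumes "p \<noteq> 0" "q \<noteq> 0" and a: "cmod a = 1"
    and bound: "\<And>z. cmod z = 1 \<Longrightarrow> cmod (poly q z) \<le> C * cmod (poly p z)"
  shows "Polynomial.order a p \<le> Polynomial.order a q"
proof (rule ccontr)
  define k where "k = Polynomial.order a p"
  define l where "l = Polynomial.order a q"
  assume "\<not> ?thesis"
  then have lk: "l < k" by (simp add: k_def l_def)
  obtain p1 where p1: "p = [:- a, 1:] ^ k * p1"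
    using order_decomp[OF assms(1)] unfolding k_def by blast
  obtain q1 where q1: "q = [:- a, 1:] ^ l * q1" "\<not> [:- a, 1:] dvd q1"
    using order_decomp[OF assms(2)] unfolding l_def by blast
  define z where "z n = a * cis (1 / real (Suc n))" for n
  have zn: "cmod (z n) = 1" for n using a by (simp add: z_def norm_mult)
  have za: "z n \<noteq> a" for n
  proof
    assume "z n = a"
    then have "cis (1 / real (Suc n)) = 1" using a by (auto simp: z_def)
    then have "sin (1 / real (Suc n)) = 0" by (metis cis.simps(2) one_complex.simps(2))
    moreover have "sin (1 / real (Suc n)) > 0"
    proof (rule sin_gt_zero)
      have "1 / real (Suc n) \<le> 1" by simp
      then show "1 / real (Suc n) < pi" using pi_gt3 by linarith
    qed simp
    ultimately show False by simp
  qed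
  have lim: "z \<longlonglongrightarrow> a"
  proof -
    have "(\<lambda>n. 1 / real (Suc n)) \<longlonglongrightarrow> 0" using LIMSEQ_inverse_real_of_nat by (simp add: inverse_eq_divide)
    then have "(\<lambda>n. a * cis (1 / real (Suc n))) \<longlonglongrightarrow> a * cis 0"
      by (intro tendsto_intros)
    then show ?thesis by (simp add: z_def[abs_def])
  qed
  have le: "cmod (poly q1 (z n)) \<le> C * (cmod (z n - a) ^ (k - l) * cmod (poly p1 (z n)))" for n
  proof -
    have pos: "cmod (z n - a) ^ l > 0" using za[of n] by simp
    have "cmod (z n - a) ^ l * cmod (poly q1 (z n)) \<le> C * (cmod (z n - a) ^ k * cmod (poly p1 (z n)))"
      using bound[OF zn[of n]] unfolding p1 q1(1) by (simp add: norm_mult norm_power)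
    also have "\<dots> = cmod (z n - a) ^ l * (C * (cmod (z n - a) ^ (k - l) * cmod (poly p1 (z n))))"
    proof -
      have "cmod (z n - a) ^ k = cmod (z n - a) ^ l * cmod (z n - a) ^ (k - l)"
        using lk by (simp add: power_add[symmetric])
      then show ?thesis by (simp only: mult_ac)
    qed
    finally show ?thesis using pos by simp
  qed
  have "cmod (poly q1 a) \<le> C * (cmod (a - a) ^ (k - l) * cmod (poly p1 a))"
  proof (rule LIMSEQ_le)
    show "(\<lambda>n. cmod (poly q1 (z n))) \<longlonglongrightarrow> cmod (poly q1 a)"
      by (intro tendsto_intros lim)
    show "(\<lambda>n. C * (cmod (z n - a) ^ (k - l) * cmod (poly p1 (z n))))
        \<longlonglongrightarrow> C * (cmod (a - a) ^ (k - l) * cmod (poly p1 a))"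
      by (intro tendsto_intros lim)
  qed (use le in blast)
  then have "poly q1 a = 0" using lk by (simp add: zero_power)
  then show False using q1(2) by (simp add: poly_eq_0_iff_dvd)
qed

text \<open>
  The quotient is written as \<open>h\<close> with \<open>q = h p\<close>, so that zeros of \<open>p\<close> on the circle need no separate
  treatment.
\<close>
lemma real_ratio_imp_multiple_of_R:
  assumes p: "p \<noteq> 0" "degree p \<le> N" and q: "degree q \<le> N"
    and ratio: "\<And>z. cmod z = 1 \<Longrightarrow> \<exists>h. \<bar>h\<bar> \<le> C \<and> poly q z = complex_of_real h * poly p z"
  obtains s where "degree s \<le> 2 * m_of N p" "star_poly (2 * m_of N p) s = s" "q = R_poly N p * s"
proof (cases "q = 0")
  case True
  then show ?thesis using that[of 0] by (simp add: star_poly_def)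
next
  case False
  define m where "m = m_of N p"
  define R where "R = R_poly N p"
  define S where "S = star_poly (N - 2 * m) R"
  note dR = degree_R_poly_le[OF p, folded m_def R_def] degree_R_poly_add_le[OF p, folded m_def R_def]
  have R: "R \<noteq> 0" using R_poly_neq_0[OF p] by (simp add: R_def)
  have S: "S \<noteq> 0" using R star_poly_eq_0_iff[OF dR(1)] by (simp add: S_def)
  have qs: "star_poly N q \<noteq> 0" using False star_poly_eq_0_iff[OF q] by simp
  have "q * star_poly N p = star_poly N q * p"
  proof (rule poly_eqI_circle)
    fix z :: complex assume z: "cmod z = 1"
    obtain h where h: "poly q z = complex_of_real h * poly p z" using ratio[OF z] by blast
    show "poly (q * star_poly N p) z = poly (star_poly N q * p) z"
      by (simp add: poly_star_poly_circle[OF _ z] p q h)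
  qed
  then have "q * (G_poly N p * S) = star_poly N q * (G_poly N p * R)"
    unfolding S_def m_def R_def
    by (simp only: star_poly_eq_G_times_star_R[OF p] G_poly_times_R_poly[OF p, symmetric])
  then have "G_poly N p * (q * S) = G_poly N p * (star_poly N q * R)"
    by (simp only: mult_ac)
  then have eq: "q * S = star_poly N q * R"
    using G_poly_neq_0[OF p] by simp
  have ord: "Polynomial.order a q + Polynomial.order a S
      = Polynomial.order a (star_poly N q) + Polynomial.order a R" for a
    using order_mult[of q S a] order_mult[of "star_poly N q" R a] False S R qs eq by simp
  have "R dvd q"
  proof (rule dvd_if_order_le[OF False R])
    fix a assume a: "poly R a = 0"
    show "Polynomial.order a R \<le> Polynomial.order a q"
    proof (cases "cmod a = 1")
      case True
      have "Polynomial.order a R \<le> Polynomial.order a p"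
        using G_poly_times_R_poly[OF p] dvd_imp_order_le[OF p(1)] by (metis R_def dvd_triv_right)
      also have "\<dots> \<le> Polynomial.order a q"
      proof (rule order_le_of_circle_bound[OF p(1) False True, where C = C])
        fix z :: complex assume "cmod z = 1"
        from ratio[OF this] show "cmod (poly q z) \<le> C * cmod (poly p z)"
          by (auto simp: norm_mult intro!: mult_right_mono)
      qed
      finally show ?thesis .
    next
      case ne: False
      then have "poly S a \<noteq> 0"
        using R_poly_no_common_zero[OF p] a by (simp add: S_def R_def m_def)
      then show ?thesis using ord[of a] by (simp add: order_0I)
    qed
  qed
  then obtain s where s: "q = R * s" by (elim dvdE)
  have s0: "s \<noteq> 0" using s False by auto
  have dq: "degree q = degree R + degree s" using s R s0 by (simp add: degree_mult_eq)
  have S_ord: "Polynomial.order 0 S = N - 2 * m - degree R"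
    unfolding S_def by (rule order_0_star_poly[OF dR(1) R])
  \<comment> \<open>If \<open>R\<close> has degree less than \<open>N - 2 m\<close>, then \<open>S\<close> vanishes at the origin and \<open>R\<close> does not, so
    \<open>star_poly N q\<close> vanishes there to at least the same order, and the degree of \<open>q\<close> drops below \<open>N\<close>
    accordingly.\<close>
  have ds: "degree s \<le> 2 * m"
  proof (cases "Polynomial.order 0 S = 0")
    case True
    then show ?thesis using S_ord dq q dR by linarith
  next
    case S0: False
    then have "poly S 0 = 0" using S by (simp add: order_eq_0_iff)
    then have "poly R 0 \<noteq> 0"
      using R_poly_no_common_zero[OF p, of 0] by (auto simp: S_def R_def m_def)
    then have "Polynomial.order 0 S \<le> Polynomial.order 0 (star_poly N q)"
      using ord[of 0] by (simp add: order_0I)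
    then show ?thesis using S_ord dq q dR order_0_star_poly[OF q False] by linarith
  qed
  have "star_poly N q = S * star_poly (2 * m) s"
  proof -
    have "N = (N - 2 * m) + 2 * m" using dR by simp
    then show ?thesis unfolding s S_def using star_poly_mult[OF dR(1) ds] by simp
  qed
  then have "(R * S) * s = (R * S) * star_poly (2 * m) s"
    using eq s by (simp add: algebra_simps)
  then have "star_poly (2 * m) s = s" using R S by simp
  then show ?thesis using that ds s by (simp add: m_def R_def)
qed

lemma self_reciprocal_ratio_real:
  assumes "degree s \<le> n" "star_poly n s = s" "degree G \<le> n" "star_poly n G = G" "cmod z = 1"
  shows "poly s z / poly G z \<in> \<real>"
proof -
  have "z \<noteq> 0" using assms(5) by auto
  moreover have "poly s z = z ^ n * cnj (poly s z)" "poly G z = z ^ n * cnj (poly G z)"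
    using poly_star_poly_circle assms by metis+
  ultimately have "poly s z / poly G z = cnj (poly s z / poly G z)"
    by (metis complex_cnj_divide mult_divide_mult_cancel_left power_not_zero)
  then show ?thesis by (simp add: Reals_cnj_iff)
qed

section \<open>Extreme points of the unit ball\<close>

lemma scaleR_poly_eq_smult: "c *\<^sub>R p = Polynomial.smult (of_real c) p" for p :: "complex poly"
  by (rule poly_eqI) (simp add: coeff_scaleR_poly scaleR_conv_of_real)

lemma poly_scaleR: "poly (c *\<^sub>R p) z = of_real c * poly p z" for p :: "complex poly"
  by (simp add: scaleR_poly_eq_smult)

lemma poly_space_add: "p \<in> poly_space \<Lambda> \<Longrightarrow> q \<in> poly_space \<Lambda> \<Longrightarrow> p + q \<in> poly_space \<Lambda>"
  unfolding poly_space_def by (auto, metis add_0)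

lemma poly_space_scaleR: "p \<in> poly_space \<Lambda> \<Longrightarrow> c *\<^sub>R p \<in> poly_space \<Lambda>"
  by (auto simp: poly_space_def coeff_scaleR_poly)

lemma poly_space_diff:
  assumes "p \<in> poly_space \<Lambda>" "q \<in> poly_space \<Lambda>"
  shows "p - q \<in> poly_space \<Lambda>"
  using poly_space_add[OF assms(1) poly_space_scaleR[OF assms(2), of "-1"]] by simp

lemma continuous_on_cmod_poly_cis: "continuous_on S (\<lambda>t. cmod (poly p (cis t)))"
  by (intro continuous_intros)

lemma integrable_cmod_poly_cis: "(\<lambda>t. cmod (poly p (cis t))) integrable_on {a..b}"
  by (intro integrable_continuous_real continuous_on_cmod_poly_cis)

lemma circle_norm1_scaleR: "circle_norm1 (c *\<^sub>R p) = \<bar>c\<bar> * circle_norm1 p"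
  by (simp add: circle_norm1_def poly_scaleR norm_mult)

lemma norm_add_eq_imp_real_multiple:
  fixes x y :: "'a :: real_inner"
  assumes "norm (x + y) = norm x + norm y"
  shows "x = (norm x / norm (x + y)) *\<^sub>R (x + y)"
proof (cases "norm (x + y) = 0")
  case True
  then show ?thesis using assms by (metis add_nonneg_eq_0_iff norm_ge_zero norm_eq_zero scaleR_zero_right)
next
  case False
  have "norm x *\<^sub>R (x + y) = norm (x + y) *\<^sub>R x"
    using assms norm_triangle_eq[of x y] by (simp add: scaleR_add_right scaleR_add_left)
  then have "(norm x / norm (x + y)) *\<^sub>R (x + y) = (1 / norm (x + y)) *\<^sub>R (norm (x + y) *\<^sub>R x)"
    by (metis scaleR_scaleR times_divide_eq_left mult_1)
  then show ?thesis using False by simp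
qed

text \<open>
  The integrand of the defect in the triangle inequality is continuous and nonnegative, so a vanishing
  defect vanishes pointwise.
\<close>
lemma circle_norm1_additive_imp:
  assumes "circle_norm1 a + circle_norm1 b \<le> circle_norm1 (a + b)" "cmod z = 1"
  shows "cmod (poly (a + b) z) = cmod (poly a z) + cmod (poly b z)"
proof -
  define f where "f t = cmod (poly a (cis t)) + cmod (poly b (cis t)) - cmod (poly (a + b) (cis t))" for t
  have f0: "f t \<ge> 0" for t by (simp add: f_def norm_triangle_ineq)
  have fc: "continuous_on {0..2 * pi} f" unfolding f_def by (intro continuous_intros)
  have "integral {0..2 * pi} f = integral {0..2 * pi} (\<lambda>t. cmod (poly a (cis t)))
      + integral {0..2 * pi} (\<lambda>t. cmod (poly b (cis t))) - integral {0..2 * pi} (\<lambda>t. cmod (poly (a + b) (cis t)))"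
    unfolding f_def
    by (subst integral_diff[OF integrable_add[OF integrable_cmod_poly_cis integrable_cmod_poly_cis] integrable_cmod_poly_cis],
        subst integral_add[OF integrable_cmod_poly_cis integrable_cmod_poly_cis]) (rule refl)
  also have "\<dots> \<le> 0"
  proof -
    have "1 / (2 * pi) * (integral {0..2 * pi} (\<lambda>t. cmod (poly a (cis t)))
      + integral {0..2 * pi} (\<lambda>t. cmod (poly b (cis t))) - integral {0..2 * pi} (\<lambda>t. cmod (poly (a + b) (cis t)))) \<le> 0"
      using assms(1) unfolding circle_norm1_def by (simp only: ring_distribs)
    then show ?thesis by (simp add: pos_divide_le_eq)
  qed
  finally have "integral {0..2 * pi} f = 0"
    using integral_nonneg[OF integrable_continuous_real[OF fc]] f0 by (meson order_antisym)
  then have all: "\<forall>t\<in>{0..2 * pi}. f t = 0"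
    using integral_eq_0_iff[OF fc] f0 by simp
  obtain t where "0 \<le> t" "t < 2 * pi" "z = cis t"
    using complex_unimodular_polar[OF assms(2)] by (metis cis_conv_exp cis.code complex_eq_iff cis.simps complex.sel)
  then show ?thesis using all by (simp add: f_def)
qed

lemma not_extreme_imp_real_ratio:
  assumes p: "p \<in> poly_space \<Lambda>" "circle_norm1 p = 1"
    and ne: "\<not> p extreme_point_of unit_ball1 \<Lambda>"
  obtains q where "q \<in> poly_space \<Lambda>" "\<nexists>c. q = c *\<^sub>R p"
    "\<And>z. cmod z = 1 \<Longrightarrow> \<exists>h. \<bar>h\<bar> \<le> 1 \<and> poly q z = complex_of_real h * poly p z"
proof -
  have "p \<in> unit_ball1 \<Lambda>" using p by (simp add: unit_ball1_def)
  then obtain a b where ab: "a \<in> unit_ball1 \<Lambda>" "b \<in> unit_ball1 \<Lambda>" "p \<in> open_segment a b"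
    using ne unfolding extreme_point_of_def by blast
  then obtain u where u: "a \<noteq> b" "0 < u" "u < 1" "p = (1 - u) *\<^sub>R a + u *\<^sub>R b"
    by (auto simp: in_segment)
  have na: "circle_norm1 a \<le> 1" "circle_norm1 b \<le> 1" "a \<in> poly_space \<Lambda>"
    using ab by (auto simp: unit_ball1_def)
  define x where "x = (1 - u) *\<^sub>R a"
  define y where "y = u *\<^sub>R b"
  have pxy: "p = x + y" using u by (simp add: x_def y_def)
  have nx: "circle_norm1 x \<le> 1 - u" "circle_norm1 y \<le> u"
    using u na by (auto simp: x_def y_def circle_norm1_scaleR mult_left_le)
  have nz: "cmod (poly p z) = cmod (poly x z) + cmod (poly y z)" if "cmod z = 1" for z
    using circle_norm1_additive_imp[of x y z] that nx p(2) by (simp add: pxy)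
  show ?thesis
  proof
    show "x \<in> poly_space \<Lambda>" using na by (simp add: x_def poly_space_scaleR)
    show "\<exists>h. \<bar>h\<bar> \<le> 1 \<and> poly x z = complex_of_real h * poly p z" if "cmod z = 1" for z
    proof (intro exI[of _ "cmod (poly x z) / cmod (poly p z)"] conjI)
      show "\<bar>cmod (poly x z) / cmod (poly p z)\<bar> \<le> 1"
      proof -
        have "cmod (poly x z) \<le> cmod (poly p z)" using nz[OF that] by simp
        then have "cmod (poly x z) / cmod (poly p z) \<le> 1"
          by (cases "poly p z = 0") simp_all
        then show ?thesis by (simp only: abs_of_nonneg divide_nonneg_nonneg norm_ge_zero)
      qed
      show "poly x z = complex_of_real (cmod (poly x z) / cmod (poly p z)) * poly p z"
        using norm_add_eq_imp_real_multiple[of "poly x z" "poly y z"] nz[OF that]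
        by (simp add: pxy scaleR_conv_of_real)
    qed
    show "\<nexists>c. x = c *\<^sub>R p"
    proof
      assume "\<exists>c. x = c *\<^sub>R p"
      then obtain c where c: "x = c *\<^sub>R p" by blast
      then have y: "y = (1 - c) *\<^sub>R p" using pxy by (simp add: algebra_simps)
      have "\<bar>c\<bar> \<le> 1 - u" "\<bar>1 - c\<bar> \<le> u"
        using nx p(2) by (simp_all add: c y circle_norm1_scaleR)
      then have "c = 1 - u" by linarith
      then have "(1 - u) *\<^sub>R a = (1 - u) *\<^sub>R p" "u *\<^sub>R b = u *\<^sub>R p"
        using c y by (simp_all add: x_def y_def)
      then show False using u(1-3) by simp
    qed
  qed
qed

lemma real_ratio_imp_not_extreme:
  assumes p: "p \<in> poly_space \<Lambda>" "circle_norm1 p = 1"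
    and q: "q \<in> poly_space \<Lambda>" "\<nexists>c. q = c *\<^sub>R p"
    and h: "continuous_on (sphere 0 1) h" "\<And>z. cmod z = 1 \<Longrightarrow> poly q z = complex_of_real (h z) * poly p z"
  shows "\<not> p extreme_point_of unit_ball1 \<Lambda>"
proof -
  let ?P = "\<lambda>t. cmod (poly p (cis t))"
  \<comment> \<open>The weighted mean of \<open>h\<close>; after subtracting it, \<open>\<integral> k \<bar>p\<bar> = 0\<close>.\<close>
  define c where "c = 1 / (2 * pi) * integral {0..2 * pi} (\<lambda>t. h (cis t) * ?P t)"
  define q' where "q' = q - c *\<^sub>R p"
  define k where "k z = h z - c" for z
  have q': "q' \<in> poly_space \<Lambda>" "q' \<noteq> 0"
    using q p by (auto simp: q'_def intro!: poly_space_diff poly_space_scaleR)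
  have kq: "poly q' z = complex_of_real (k z) * poly p z" if "cmod z = 1" for z
    using h(2)[OF that] by (simp add: q'_def k_def poly_scaleR algebra_simps)
  have hc: "continuous_on S (\<lambda>t. h (cis t))" for S
    by (rule continuous_on_compose2[OF h(1)]) (auto intro!: continuous_intros)
  have kc: "continuous_on (sphere 0 1) k" unfolding k_def by (intro continuous_intros h)
  have "compact (k ` sphere 0 1)" by (rule compact_continuous_image[OF kc compact_sphere])
  then obtain B where B: "B > 0" "\<And>z. cmod z = 1 \<Longrightarrow> \<bar>k z\<bar> \<le> B"
    using compact_imp_bounded bounded_pos[of "k ` sphere 0 1"] by auto
  have int0: "1 / (2 * pi) * integral {0..2 * pi} (\<lambda>t. k (cis t) * ?P t) = 0"
  proof -
    have "integral {0..2 * pi} (\<lambda>t. k (cis t) * ?P t)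
       = integral {0..2 * pi} (\<lambda>t. h (cis t) * ?P t - c * ?P t)"
      by (simp add: k_def algebra_simps)
    also have "\<dots> = integral {0..2 * pi} (\<lambda>t. h (cis t) * ?P t) - integral {0..2 * pi} (\<lambda>t. c * ?P t)"
      by (intro integral_diff integrable_continuous_real continuous_intros hc)
    finally show ?thesis using p(2) by (simp add: c_def circle_norm1_def algebra_simps)
  qed
  \<comment> \<open>For \<open>\<bar>e\<bar> = 1 / B\<close> the factor \<open>1 + e k\<close> is nonnegative on the circle, so the norm is linear in \<open>e\<close>.\<close>
  have norm1: "circle_norm1 (p + e *\<^sub>R q') = 1" if e: "\<bar>e\<bar> = 1 / B" for e
  proof -
    have eq: "cmod (poly (p + e *\<^sub>R q') (cis t)) = ?P t + e * (k (cis t) * ?P t)" for t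
    proof -
      have "\<bar>e * k (cis t)\<bar> \<le> 1"
        using B(1) B(2)[of "cis t"] by (simp add: abs_mult e)
      then have "\<bar>1 + e * k (cis t)\<bar> = 1 + e * k (cis t)" by linarith
      moreover have "poly (p + e *\<^sub>R q') (cis t) = complex_of_real (1 + e * k (cis t)) * poly p (cis t)"
        using kq[of "cis t"] by (simp add: poly_scaleR algebra_simps)
      ultimately show ?thesis by (simp only: norm_mult norm_of_real) (simp add: algebra_simps)
    qed
    have "integral {0..2 * pi} (\<lambda>t. ?P t + e * (k (cis t) * ?P t))
       = integral {0..2 * pi} ?P + integral {0..2 * pi} (\<lambda>t. e * (k (cis t) * ?P t))"
      unfolding k_def by (intro integral_add integrable_continuous_real continuous_intros hc)
    then have "circle_norm1 (p + e *\<^sub>R q') = circle_norm1 p + e * (1 / (2 * pi) * integral {0..2 * pi} (\<lambda>t. k (cis t) * ?P t))"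
      unfolding circle_norm1_def eq by (simp add: algebra_simps)
    then show ?thesis unfolding int0 using p(2) by simp
  qed
  let ?a = "p + (1 / B) *\<^sub>R q'" and ?b = "p + (- (1 / B)) *\<^sub>R q'"
  have mem: "?a \<in> unit_ball1 \<Lambda>" "?b \<in> unit_ball1 \<Lambda>"
    unfolding unit_ball1_def using norm1[of "1 / B"] norm1[of "- (1 / B)"] B(1)
    by (auto simp del: scaleR_minus_left intro!: poly_space_add poly_space_scaleR p q')
  have half: "x = (1 - 1 / 2) *\<^sub>R (x + y) + (1 / 2) *\<^sub>R (x - y)" for x y :: "complex poly"
  proof -
    have "(x + y) + (x - y) = x + x" by simp
    then have "(1 / 2) *\<^sub>R ((x + y) + (x - y)) = x" by (simp only: scaleR_half_double)
    then show ?thesis by (simp only: scaleR_add_right) simp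
  qed
  have eq: "?a - ?b = (2 / B) *\<^sub>R q'"
    by (simp add: scaleR_left_distrib[symmetric])
  have "(2 / B) *\<^sub>R q' \<noteq> 0" using B(1) q' by simp
  then have ne: "?a \<noteq> ?b"
    by (metis diff_self eq)
  have mid: "p = (1 - 1 / 2) *\<^sub>R ?a + (1 / 2) *\<^sub>R ?b"
  proof -
    have "?b = p - (1 / B) *\<^sub>R q'" by simp
    then show ?thesis by (simp only:) (rule half)
  qed
  have "0 < 1 / (2::real)" "1 / 2 < (1::real)" by simp_all
  with ne mid have "p \<in> open_segment ?a ?b"
    unfolding in_segment by blast
  then show ?thesis using mem unfolding extreme_point_of_def by blast
qed

lemma extreme_point_iff_self_reciprocal:
  assumes p: "p \<noteq> 0" "degree p \<le> N" "p \<in> poly_space \<Lambda>" "circle_norm1 p = 1" and \<Lambda>: "\<Lambda> \<subseteq> {0..N}"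
  shows "p extreme_point_of unit_ball1 \<Lambda> \<longleftrightarrow>
    (\<forall>s. degree s \<le> 2 * m_of N p \<longrightarrow> star_poly (2 * m_of N p) s = s \<longrightarrow> R_poly N p * s \<in> poly_space \<Lambda>
      \<longrightarrow> (\<exists>c. s = c *\<^sub>R G_poly N p))"
proof -
  let ?m = "m_of N p" and ?R = "R_poly N p" and ?G = "G_poly N p"
  have multiple: "(\<exists>c. ?R * s = c *\<^sub>R p) \<longleftrightarrow> (\<exists>c. s = c *\<^sub>R ?G)" for s
  proof -
    have "?R * s = c *\<^sub>R p \<longleftrightarrow> s = c *\<^sub>R ?G" for c
    proof -
      have "c *\<^sub>R p = ?R * (c *\<^sub>R ?G)"
        using G_poly_times_R_poly[OF p(1,2)] by (metis scaleR_poly_eq_smult mult.commute mult_smult_right)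
      then show ?thesis using R_poly_neq_0[OF p(1,2)] by simp
    qed
    then show ?thesis by simp
  qed
  show ?thesis
  proof (intro iffI allI impI)
    fix s assume ext: "p extreme_point_of unit_ball1 \<Lambda>"
      and s: "degree s \<le> 2 * ?m" "star_poly (2 * ?m) s = s" "?R * s \<in> poly_space \<Lambda>"
    define h where "h z = Re (poly s z / poly ?G z)" for z
    have Gz: "poly ?G z \<noteq> 0" if "cmod z = 1" for z
      using poly_G_poly_circle[OF p(1,2) that] .
    have hc: "continuous_on (sphere 0 1) h"
      unfolding h_def by (intro continuous_intros) (use Gz in auto)
    have hq: "poly (?R * s) z = complex_of_real (h z) * poly p z" if z: "cmod z = 1" for z
    proof -
      have "complex_of_real (h z) = poly s z / poly ?G z"
        using self_reciprocal_ratio_real[OF s(1,2) degree_G_poly_le[OF p(1,2)] star_G_poly[OF p(1,2)] z]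
        by (simp add: h_def)
      moreover have "poly p z = poly ?G z * poly ?R z"
        using G_poly_times_R_poly[OF p(1,2)] by (metis poly_mult)
      ultimately show ?thesis using Gz[OF z] by simp
    qed
    show "\<exists>c. s = c *\<^sub>R ?G"
      using real_ratio_imp_not_extreme[OF p(3,4) s(3) _ hc hq] ext multiple by blast
  next
    assume all: "\<forall>s. degree s \<le> 2 * ?m \<longrightarrow> star_poly (2 * ?m) s = s \<longrightarrow> ?R * s \<in> poly_space \<Lambda>
      \<longrightarrow> (\<exists>c. s = c *\<^sub>R ?G)"
    show "p extreme_point_of unit_ball1 \<Lambda>"
    proof (rule ccontr)
      assume "\<not> ?thesis"
      then obtain q where q: "q \<in> poly_space \<Lambda>" "\<nexists>c. q = c *\<^sub>R p"
        "\<And>z. cmod z = 1 \<Longrightarrow> \<exists>h. \<bar>h\<bar> \<le> 1 \<and> poly q z = complex_of_real h * poly p z"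
        using not_extreme_imp_real_ratio[OF p(3,4)] by metis
      have "degree q \<le> N"
        using q(1) \<Lambda> by (intro degree_le) (auto simp: poly_space_def subset_iff)
      then obtain s where s: "degree s \<le> 2 * ?m" "star_poly (2 * ?m) s = s" "q = ?R * s"
        using real_ratio_imp_multiple_of_R[OF p(1,2) _ q(3)] by metis
      then show False using all q multiple by metis
    qed
  qed
qed

section \<open>Coordinates of self-reciprocal polynomials and the rank condition\<close>

text \<open>
  The coefficients of \<open>z ^ m * (2 v\<^sub>0 + (\<Sum>l = 1..m. \<gamma>\<^sub>l z ^ l + cnj \<gamma>\<^sub>l z ^ (- l)))\<close> with
  \<open>\<gamma>\<^sub>l = v\<^sub>l + \<i> v\<^bsub>m + l\<^esub>\<close>.  The factor \<open>2\<close> at \<open>v\<^sub>0\<close> matches the column \<open>l = 0\<close> of the plus matrices,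
  whose entries are twice the real or imaginary part of a coefficient.
\<close>
definition real_coords_coeff :: "nat \<Rightarrow> real vec \<Rightarrow> nat \<Rightarrow> complex" where
  "real_coords_coeff m v i =
    (if i = m then of_real (2 * v $ 0)
     else if m < i then Complex (v $ (i - m)) (v $ i)
     else Complex (v $ (m - i)) (- v $ (2 * m - i)))"

text \<open>
  The polynomial of degree at most \<open>2 m\<close> that is fixed by \<open>star_poly (2 m)\<close> and has the real coordinate
  vector \<open>v\<close> of length \<open>2 m + 1\<close>.
\<close>
definition self_reciprocal_poly :: "nat \<Rightarrow> real vec \<Rightarrow> complex poly" where
  "self_reciprocal_poly m v = (\<Sum>i\<le>2 * m. Polynomial.monom (real_coords_coeff m v i) i)"

lemma coeff_self_reciprocal_poly:
  "poly.coeff (self_reciprocal_poly m v) i = (if i \<le> 2 * m then real_coords_coeff m v i else 0)"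
  by (simp add: self_reciprocal_poly_def coeff_sum)

lemma degree_self_reciprocal_poly: "degree (self_reciprocal_poly m v) \<le> 2 * m"
  by (rule degree_le) (simp add: coeff_self_reciprocal_poly)

lemma star_self_reciprocal_poly: "star_poly (2 * m) (self_reciprocal_poly m v) = self_reciprocal_poly m v"
proof (rule poly_eqI)
  fix i
  consider "i < m" | "i = m" | "m < i" "i \<le> 2 * m" | "2 * m < i" by linarith
  then show "poly.coeff (star_poly (2 * m) (self_reciprocal_poly m v)) i
      = poly.coeff (self_reciprocal_poly m v) i"
    by cases (auto simp: coeff_star_poly coeff_self_reciprocal_poly real_coords_coeff_def
        complex_eq_iff intro!: arg_cong[of _ _ "($) v"])
qed

lemma self_reciprocal_poly_surj:
  assumes "degree s \<le> 2 * m" "star_poly (2 * m) s = s"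
  obtains v where "v \<in> carrier_vec (Suc (2 * m))" "self_reciprocal_poly m v = s"
proof -
  define v where "v = vec (Suc (2 * m)) (\<lambda>i. if i = 0 then Re (poly.coeff s m) / 2
     else if i \<le> m then Re (poly.coeff s (m + i)) else Im (poly.coeff s i))"
  have sym: "poly.coeff s i = cnj (poly.coeff s (2 * m - i))" if "i \<le> 2 * m" for i
    using assms(2) that coeff_star_poly[of "2 * m" s i] by simp
  have "self_reciprocal_poly m v = s"
  proof (rule poly_eqI)
    fix i
    consider "i < m" | "i = m" | "m < i" "i \<le> 2 * m" | "2 * m < i" by linarith
    then show "poly.coeff (self_reciprocal_poly m v) i = poly.coeff s i"
    proof cases
      case 1
      then have "m + (m - i) = 2 * m - i" "\<not> 2 * m - i \<le> m" by simp_all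
      then show ?thesis
        using 1 sym[of i] by (simp add: coeff_self_reciprocal_poly real_coords_coeff_def v_def complex_eq_iff)
    next
      case 2
      then show ?thesis
        using sym[of m] by (simp add: coeff_self_reciprocal_poly real_coords_coeff_def v_def complex_eq_iff)
    next
      case 3
      then have "i - m \<le> m" by linarith
      then show ?thesis
        using 3 by (simp add: coeff_self_reciprocal_poly real_coords_coeff_def v_def complex_eq_iff)
    next
      case 4
      then show ?thesis
        using assms(1) by (simp add: coeff_self_reciprocal_poly coeff_eq_0)
    qed
  qed
  then show ?thesis using that[of v] by (simp add: v_def)
qed

lemma self_reciprocal_poly_smult:
  assumes "v \<in> carrier_vec (Suc (2 * m))"
  shows "self_reciprocal_poly m (c \<cdot>\<^sub>v v) = c *\<^sub>R self_reciprocal_poly m v"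
  using assms
  by (intro poly_eqI) (auto simp: coeff_self_reciprocal_poly coeff_scaleR_poly real_coords_coeff_def complex_eq_iff)

lemma self_reciprocal_poly_inj:
  assumes v: "v \<in> carrier_vec (Suc (2 * m))" and w: "w \<in> carrier_vec (Suc (2 * m))"
    and eq: "self_reciprocal_poly m v = self_reciprocal_poly m w"
  shows "v = w"
proof (rule eq_vecI)
  fix i assume "i < dim_vec w"
  then have i: "i \<le> 2 * m" using w by simp
  have co: "real_coords_coeff m v j = real_coords_coeff m w j" if "j \<le> 2 * m" for j
    using eq that by (metis coeff_self_reciprocal_poly)
  consider "i = 0" | "0 < i" "i \<le> m" | "m < i" using i by linarith
  then show "v $ i = w $ i"
  proof cases
    case 1 then show ?thesis using co[of m] by (simp add: real_coords_coeff_def)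
  next
    case 2 then show ?thesis using co[of "m + i"] by (simp add: real_coords_coeff_def)
  next
    case 3 then show ?thesis using co[of i] i by (simp add: real_coords_coeff_def)
  qed
qed (use v w in simp)

lemma sum_symmetric_about_middle:
  fixes f :: "nat \<Rightarrow> 'a :: comm_monoid_add"
  shows "(\<Sum>i\<le>2 * m. f i) = f m + (\<Sum>l<m. f (m + Suc l) + f (m - Suc l))"
proof -
  have "(\<Sum>i\<le>m + n. f i) = (\<Sum>i<m. f i) + f m + (\<Sum>l<n. f (m + Suc l))" for n
    by (induction n) (simp_all add: add.assoc lessThan_Suc_atMost[symmetric])
  moreover have "(\<Sum>i<m. f i) = (\<Sum>l<m. f (m - Suc l))"
    by (rule sum.nat_diff_reindex[symmetric])
  ultimately show ?thesis
    by (simp add: mult_2 sum.distrib add_ac)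
qed

lemma sum_split_halves:
  fixes f :: "nat \<Rightarrow> 'a :: comm_monoid_add"
  shows "(\<Sum>c<Suc (2 * m). f c) = f 0 + (\<Sum>l<m. f (Suc l) + f (m + Suc l))"
proof -
  have shift: "(\<Sum>c<Suc m. f c) = f 0 + (\<Sum>l<m. f (Suc l))"
    by (rule sum.lessThan_Suc_shift)
  have "(\<Sum>c<Suc (m + n). f c) = (f 0 + (\<Sum>l<m. f (Suc l))) + (\<Sum>l<n. f (m + Suc l))" for n
  proof (induction n)
    case 0
    show ?case using shift by (simp only: add_0_right lessThan_0 sum.empty)
  next
    case (Suc n)
    have "(\<Sum>c<Suc (m + Suc n). f c) = (\<Sum>c<Suc (m + n). f c) + f (m + Suc n)"
      by (simp only: add_Suc_right sum.lessThan_Suc[of _ "Suc (m + n)"])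
    then show ?case unfolding Suc.IH by (simp only: sum.lessThan_Suc[of _ n] add.assoc)
  qed
  from this[of m] show ?thesis by (simp only: mult_2 sum.distrib add.assoc)
qed

text \<open>
  With the coefficients of \<open>R\<close> extended by zero to all integers, the convolution runs over all
  coefficients of \<open>s\<close> irrespective of \<open>\<kappa>\<close>.
\<close>
lemma coeff_R_poly_mult:
  assumes "degree s \<le> n"
  shows "poly.coeff (R_poly N p * s) \<kappa> = (\<Sum>i\<le>n. poly.coeff s i * C_coeff N p (int \<kappa> - int i))"
proof -
  have "poly.coeff (R_poly N p * s) \<kappa> = (\<Sum>i\<le>\<kappa>. poly.coeff s i * poly.coeff (R_poly N p) (\<kappa> - i))"
    by (subst mult.commute) (simp add: coeff_mult)
  also have "\<dots> = (\<Sum>i\<le>\<kappa>. poly.coeff s i * C_coeff N p (int \<kappa> - int i))"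
    by (rule sum.cong) (auto simp: C_coeff_def nat_diff_distrib)
  also have "\<dots> = (\<Sum>i\<le>max \<kappa> n. poly.coeff s i * C_coeff N p (int \<kappa> - int i))"
    by (rule sum.mono_neutral_left) (auto simp: C_coeff_def)
  also have "\<dots> = (\<Sum>i\<le>n. poly.coeff s i * C_coeff N p (int \<kappa> - int i))"
    by (rule sum.mono_neutral_right) (use assms in \<open>auto simp: coeff_eq_0\<close>)
  finally show ?thesis .
qed

lemma coeff_R_poly_mult_self_reciprocal:
  fixes N p \<kappa> m v
  defines "C \<equiv> C_coeff N p"
  shows "poly.coeff (R_poly N p * self_reciprocal_poly m v) \<kappa> =
    of_real (2 * v $ 0) * C (int \<kappa> - int m)
    + (\<Sum>l<m. Complex (v $ Suc l) (v $ (m + Suc l)) * C (int \<kappa> - int (Suc l) - int m)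
       + Complex (v $ Suc l) (- v $ (m + Suc l)) * C (int \<kappa> + int (Suc l) - int m))"
proof -
  have 1: "2 * m - (m - Suc l) = m + Suc l" if "l < m" for l using that by simp
  show ?thesis
    unfolding coeff_R_poly_mult[OF degree_self_reciprocal_poly] sum_symmetric_about_middle C_def[symmetric]
    by (intro arg_cong2[of _ _ _ _ "(+)"] sum.cong arg_cong2[of _ _ _ _ "(*)"])
      (auto simp: coeff_self_reciprocal_poly real_coords_coeff_def 1 of_nat_diff algebra_simps intro!: arg_cong[of _ _ C])
qed

lemma frakM_carrier: "frakM N M k p \<in> carrier_mat (M + M) (Suc (2 * m_of N p))"
proof -
  have "frakM N M k p \<in> carrier_mat (M + M) ((m_of N p + 1) + m_of N p)"
    unfolding frakM_def Let_def
    by (rule four_block_carrier_mat) (simp_all add: plus_mat_def minus_mat_def)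
  then show ?thesis by (simp add: mult_2)
qed

text \<open>
  Rows \<open>i\<close> and \<open>M + i\<close> belong to the excluded exponent \<open>k (i + 1)\<close>.
\<close>

lemma frakM_mult_vec_index:
  fixes N p k M
  defines "m \<equiv> m_of N p"
  assumes v: "v \<in> carrier_vec (Suc (2 * m))" and i: "i < M"
  shows "(frakM N M k p *\<^sub>v v) $ i = Re (poly.coeff (R_poly N p * self_reciprocal_poly m v) (k (Suc i)))"
    "(frakM N M k p *\<^sub>v v) $ (M + i) = Im (poly.coeff (R_poly N p * self_reciprocal_poly m v) (k (Suc i)))"
proof -
  have dims: "dim_row (frakM N M k p) = M + M" "dim_col (frakM N M k p) = Suc (2 * m)" "dim_vec v = Suc (2 * m)"
    unfolding m_def
    by (rule carrier_matD(1)[OF frakM_carrier] carrier_matD(2)[OF frakM_carrier]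
          carrier_vecD[OF v[unfolded m_def]])+
  have idx: "(frakM N M k p *\<^sub>v v) $ r = (\<Sum>c<Suc (2 * m). frakM N M k p $$ (r, c) * v $ c)" if r: "r < M + M" for r
  proof -
    have "(frakM N M k p *\<^sub>v v) $ r = row (frakM N M k p) r \<bullet> v"
      using r by (simp only: index_mult_mat_vec dims)
    also have "\<dots> = (\<Sum>c<Suc (2 * m). row (frakM N M k p) r $ c * v $ c)"
      by (simp only: scalar_prod_def dims atLeast0LessThan)
    also have "\<dots> = (\<Sum>c<Suc (2 * m). frakM N M k p $$ (r, c) * v $ c)"
      by (rule sum.cong) (simp_all add: dims r)
    finally show ?thesis .
  qed
  let ?j = "k (Suc i)"
  show "(frakM N M k p *\<^sub>v v) $ i = Re (poly.coeff (R_poly N p * self_reciprocal_poly m v) ?j)"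
    unfolding idx[OF trans_less_add1[OF i]] sum_split_halves coeff_R_poly_mult_self_reciprocal
    using i
    by (auto simp: frakM_def Let_def plus_mat_def minus_mat_def m_def[symmetric] plus_entry_def minus_entry_def
        A_coeff_def B_coeff_def sum.distrib sum_subtractf algebra_simps)
  have Mi: "M + i < M + M" using i by simp
  show "(frakM N M k p *\<^sub>v v) $ (M + i) = Im (poly.coeff (R_poly N p * self_reciprocal_poly m v) ?j)"
    unfolding idx[OF Mi] sum_split_halves coeff_R_poly_mult_self_reciprocal
    using i
    by (auto simp: frakM_def Let_def plus_mat_def minus_mat_def m_def[symmetric] plus_entry_def minus_entry_def
        A_coeff_def B_coeff_def sum.distrib sum_subtractf algebra_simps)
qed

lemma frakM_kernel_iff:
  assumes p: "p \<noteq> 0" "degree p \<le> N" and v: "v \<in> carrier_vec (Suc (2 * m_of N p))"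
  shows "frakM N M k p *\<^sub>v v = 0\<^sub>v (M + M)
    \<longleftrightarrow> R_poly N p * self_reciprocal_poly (m_of N p) v \<in> poly_space (spectrum_set N M k)"
    (is "?A *\<^sub>v v = _ \<longleftrightarrow> ?q \<in> _")
proof -
  have dq: "degree ?q \<le> N"
    using degree_mult_le[of "R_poly N p" "self_reciprocal_poly (m_of N p) v"]
      degree_self_reciprocal_poly[of "m_of N p" v] degree_R_poly_add_le[OF p] by linarith
  have A: "?A \<in> carrier_mat (M + M) (Suc (2 * m_of N p))" by (rule frakM_carrier)
  have "?A *\<^sub>v v = 0\<^sub>v (M + M) \<longleftrightarrow> (\<forall>r<M + M. (?A *\<^sub>v v) $ r = 0)"
    using A by (auto simp: vec_eq_iff)
  also have "\<dots> \<longleftrightarrow> (\<forall>i<M. (?A *\<^sub>v v) $ i = 0 \<and> (?A *\<^sub>v v) $ (M + i) = 0)"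
  proof (intro iffI allI impI)
    fix r assume *: "\<forall>i<M. (?A *\<^sub>v v) $ i = 0 \<and> (?A *\<^sub>v v) $ (M + i) = 0" and r: "r < M + M"
    show "(?A *\<^sub>v v) $ r = 0"
    proof (cases "r < M")
      case False
      then obtain i where "r = M + i" "i < M" using r by (metis le_Suc_ex nat_add_left_cancel_less not_less)
      then show ?thesis using * by simp
    qed (use * in simp)
  qed auto
  also have "\<dots> \<longleftrightarrow> (\<forall>i<M. poly.coeff ?q (k (Suc i)) = 0)"
    using frakM_mult_vec_index[OF v] by (simp add: complex_eq_iff)
  also have "\<dots> \<longleftrightarrow> (\<forall>j\<in>{1..M}. poly.coeff ?q (k j) = 0)"
    by (auto simp: Suc_le_eq dest!: gr0_implies_Suc)
  also have "\<dots> \<longleftrightarrow> ?q \<in> poly_space (spectrum_set N M k)"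
    unfolding poly_space_def spectrum_set_def using dq by (auto simp: le_degree intro: order_trans[OF le_degree])
  finally show ?thesis .
qed

theorem theorem2p1:
  fixes N M :: nat and k :: "nat \<Rightarrow> nat" and p :: "complex poly"
  assumes "0 < N"
    and "\<forall>j\<in>{1..M}. 0 < k j \<and> k j < N"
    and "strict_mono_on {1..M} k"
    and "p \<in> poly_space (spectrum_set N M k)"
    and "circle_norm1 p = 1"
  shows "p extreme_point_of unit_ball1 (spectrum_set N M k)
         \<longleftrightarrow> mat_rank (frakM N M k p) = 2 * m_of N p"
proof -
  let ?\<Lambda> = "spectrum_set N M k" and ?A = "frakM N M k p"
  define m where "m = m_of N p"
  have \<Lambda>: "?\<Lambda> \<subseteq> {0..N}" by (auto simp: spectrum_set_def)
  have p0: "p \<noteq> 0"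
    using assms(5) by (auto simp: circle_norm1_def)
  have dp: "degree p \<le> N"
    using assms(4) \<Lambda> by (intro degree_le) (auto simp: poly_space_def subset_iff)
  note p = p0 dp
  note ker = frakM_kernel_iff[OF p, of _ M k, folded m_def]
  have A: "?A \<in> carrier_mat (M + M) (Suc (2 * m))"
    unfolding m_def by (rule frakM_carrier)
  obtain u where u: "u \<in> carrier_vec (Suc (2 * m))" "self_reciprocal_poly m u = G_poly N p"
    using self_reciprocal_poly_surj[OF degree_G_poly_le[OF p] star_G_poly[OF p]] unfolding m_def by metis
  have "u \<noteq> 0\<^sub>v (Suc (2 * m))"
  proof
    assume "u = 0\<^sub>v (Suc (2 * m))"
    then have "0 \<cdot>\<^sub>v u = u" by auto
    then have "G_poly N p = 0"
      using self_reciprocal_poly_smult[OF u(1), of 0] u(2) by simp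
    then show False using G_poly_neq_0[OF p] by simp
  qed
  moreover have "?A *\<^sub>v u = 0\<^sub>v (M + M)"
    using ker[OF u(1)] u(2) assms(4) G_poly_times_R_poly[OF p] by (simp add: mult.commute)
  ultimately have "vec_space.rank (M + M) ?A = 2 * m \<longleftrightarrow>
      (\<forall>v\<in>carrier_vec (Suc (2 * m)). ?A *\<^sub>v v = 0\<^sub>v (M + M) \<longrightarrow> (\<exists>c. v = c \<cdot>\<^sub>v u))"
    by (intro rank_eq_ncols_minus_1_iff[OF A u(1)])
  also have "\<dots> \<longleftrightarrow> (\<forall>v\<in>carrier_vec (Suc (2 * m)). R_poly N p * self_reciprocal_poly m v \<in> poly_space ?\<Lambda>
      \<longrightarrow> (\<exists>c. self_reciprocal_poly m v = c *\<^sub>R G_poly N p))"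
  proof -
    have "v = c \<cdot>\<^sub>v u \<longleftrightarrow> self_reciprocal_poly m v = c *\<^sub>R G_poly N p" if "v \<in> carrier_vec (Suc (2 * m))" for v c
      using self_reciprocal_poly_inj[OF that smult_carrier_vec[THEN iffD2, OF u(1)], of c]
        self_reciprocal_poly_smult[OF u(1), of c] u(2) by auto
    then show ?thesis using ker by simp
  qed
  also have "\<dots> \<longleftrightarrow> (\<forall>s. degree s \<le> 2 * m \<longrightarrow> star_poly (2 * m) s = s \<longrightarrow> R_poly N p * s \<in> poly_space ?\<Lambda>
      \<longrightarrow> (\<exists>c. s = c *\<^sub>R G_poly N p))"
    using self_reciprocal_poly_surj degree_self_reciprocal_poly star_self_reciprocal_poly by metis
  also have "\<dots> \<longleftrightarrow> p extreme_point_of unit_ball1 ?\<Lambda>"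
    unfolding m_def by (rule extreme_point_iff_self_reciprocal[OF p assms(4,5) \<Lambda>, symmetric])
  finally show ?thesis
    using A by (simp add: mat_rank_def m_def)
qed

end
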